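(* Let $X$ be an arbitrary set. Then: (i) For any sampling net $\varphi \in \Phi(X)$, with $\varphi=\{\varphi_\lambda,\ \lambda\in\Lambda,\ \geq\}$, any $m \in \mathbb{N}$ and any bounded mapping $\gamma : X \to \mathbb{R}^m$, the set of limit points in $\mathbb{R}^m$ of the net of averages $$\{y_\lambda,\ \lambda\in\Lambda,\ \geq\},\qquad y_\lambda=\frac{1}{n_\lambda}\sum_{i=1}^{n_\lambda}\gamma(\varphi_{\lambda i}),$$ equals $P_\varphi(\gamma)$. (ii) The mapping $\varphi \mapsto P_\varphi$ defined on $\Phi(X)$ is the (complete) invariant of the relation of $S$-equivalence: for all $\varphi^{(1)},\varphi^{(2)}\in\Phi(X)$, $\varphi^{(1)}$ and $\varphi^{(2)}$ are $S$-equivalent if and only if $P_{\varphi^{(1)}}=P_{\varphi^{(2)}}$. (iii) The mapping $\varphi\mapsto P_\varphi$ is a mapping from $\Phi(X)$ onto the whole set $\mathbb{P}(X)$; that is, $P_\varphi \in \mathbb{P}(X)$ for every $\varphi\in\Phi(X)$, and for every $P\in\mathbb{P}(X)$ there is $\varphi\in\Phi(X)$ with $P_\varphi=P$. Consequently this mapping puts the classes of $S$-equivalence of sampling nets in $X$ and the regularities on $X$ into one-to-one correspondence.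
   Context: Let $M$ be the Banach space of bounded real functions on $X$ (sup norm), $M^*$ its dual, and $\tau$ the weak-$*$ topology on $M^*$. Let $$PF(X)=\{p\in M^* : p(f)\ge 0 \text{ if } f\ge 0,\ p(\mathbf{1}_X)=1\},$$ with the topology induced by $\tau$, where $\mathbf{1}_A$ is the characteristic function of $A\subseteq X$. Write $p(A)=p(\mathbf{1}_A)$; elements of $PF(X)$ are identified with finitely additive normed measures on $2^X$, and $p(f)=\int f(x)\,p(dx)$. A regularity on $X$ is any non-empty closed subset of $PF(X)$; $\mathbb{P}(X)$ is the set of all regularities on $X$. For $P\subseteq PF(X)$ and a bounded $\gamma=(\gamma_1,\dots,\gamma_m):X\to\mathbb{R}^m$, $$P(\gamma)=\{(p(\gamma_1),\dots,p(\gamma_m)) : p\in P\}\subseteq\mathbb{R}^m.$$ A net is a function on a non-empty directed set (a set with a reflexive transitive relation in which any two elements have a common upper bound). A limit point of a net $\{g_\alpha,\alpha\in A\}$ in a topological space is a point $x$ such that for every neighbourhood $V$ of $x$ and every $\alpha_0\in A$ there is $\alpha\ge\alpha_0$ with $g_\alpha\in V$ (equivalently, the limit of some subnet). A sampling net in $X$ is any net $\varphi=\{\varphi_\lambda,\lambda\in\Lambda,\geq\}$ with values in $X^\infty=\bigcup_{n=1}^\infty X^n$ (disjoint union of the sets of $n$-tuples). If $\varphi_\lambda\in X^n$, write $n_\lambda=n$ and $\varphi_\lambda=(\varphi_{\lambda 1},\dots,\varphi_{\lambda n_\lambda})$, and let $p_\varphi^{(\lambda)}\in PF(X)$ be $$p_\varphi^{(\lambda)}(A)=\frac1{n_\lambda}\sum_{i=1}^{n_\lambda}\mathbf{1}_A(\varphi_{\lambda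 i}),\quad A\subseteq X.$$ $P_\varphi$ (the regularity of $\varphi$) is the set of limit points in $PF(X)$ of the net $\{p_\varphi^{(\lambda)},\lambda\in\Lambda,\ge\}$. $\Phi(X)$ is the class of all sampling nets in $X$ (over arbitrary directed sets). Sampling nets $\varphi^{(1)},\varphi^{(2)}\in\Phi(X)$, on directed sets $\Lambda_1,\Lambda_2$ respectively, are $S$-equivalent if and only if for every $m\in\mathbb{N}$ and every bounded $\gamma:X\to\mathbb{R}^m$ the set of limit points of the net of averages $\{y_\lambda^{(k)},\lambda\in\Lambda_k,\ge\}$, $y_\lambda^{(k)}=\frac1{n_\lambda}\sum_{i=1}^{n_\lambda}\gamma(\varphi^{(k)}_{\lambda i})$ (with $n_\lambda$ the length of $\varphi^{(k)}_\lambda$), does not depend on $k\in\{1,2\}$. *)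

theory Defs
  imports "HOL-Analysis.Analysis"
begin

section \<open>Finitely additive probabilities and regularities\<close>

text \<open>A real function on the set \<open>X\<close> is represented by an extensional function.\<close>

definition bounded_functions :: "'x set \<Rightarrow> ('x \<Rightarrow> real) set" where
  "bounded_functions X = {f \<in> extensional X. bounded (f ` X)}"

definition sup_norm :: "'x set \<Rightarrow> ('x \<Rightarrow> real) \<Rightarrow> real" where
  "sup_norm X f = (SUP x\<in>X. \<bar>f x\<bar>)"

definition dual_space :: "'x set \<Rightarrow> (('x \<Rightarrow> real) \<Rightarrow> real) set" where
  "dual_space X = {p \<in> extensional (bounded_functions X).
     (\<forall>f\<in>bounded_functions X. \<forall>g\<in>bounded_functions X.
        p (\<lambda>x\<in>X. f x + g x) = p f + p g) \<and>
     (\<forall>c. \<forall>f\<in>bounded_functions X. p (\<lambda>x\<in>X. c * f x) = c * p f) \<and>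
     (\<exists>C. \<forall>f\<in>bounded_functions X. \<bar>p f\<bar> \<le> C * sup_norm X f)}"

text \<open>The coarsest topology on the dual that makes all evaluations \<open>p \<mapsto> p f\<close> continuous.\<close>

definition weak_star_topology :: "'x set \<Rightarrow> (('x \<Rightarrow> real) \<Rightarrow> real) topology" where
  "weak_star_topology X =
     subtopology (product_topology (\<lambda>_. euclideanreal) (bounded_functions X)) (dual_space X)"

definition char_fun :: "'x set \<Rightarrow> 'x set \<Rightarrow> 'x \<Rightarrow> real" where
  "char_fun X A = restrict (indicat_real A) X"

definition PF :: "'x set \<Rightarrow> (('x \<Rightarrow> real) \<Rightarrow> real) set" where
  "PF X = {p \<in> dual_space X.
     (\<forall>f\<in>bounded_functions X. (\<forall>x\<in>X. 0 \<le> f x) \<longrightarrow> 0 \<le> p f) \<and> p (char_fun X X) = 1}"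

definition PF_topology :: "'x set \<Rightarrow> (('x \<Rightarrow> real) \<Rightarrow> real) topology" where
  "PF_topology X = subtopology (weak_star_topology X) (PF X)"

definition regularities :: "'x set \<Rightarrow> (('x \<Rightarrow> real) \<Rightarrow> real) set set" where
  "regularities X = {P. P \<noteq> {} \<and> closedin (PF_topology X) P}"

text \<open>
  Points of the \<open>m\<close>-dimensional real space are the elements of \<open>topspace (Euclidean_space m)\<close>,
  i.e. sequences that vanish from index \<open>m\<close> on; the coordinates are numbered from 0.
\<close>

definition bounded_map :: "'x set \<Rightarrow> nat \<Rightarrow> ('x \<Rightarrow> nat \<Rightarrow> real) \<Rightarrow> bool" where
  "bounded_map X m \<gamma> \<longleftrightarrow>
     \<gamma> \<in> X \<rightarrow> topspace (Euclidean_space m) \<and> (\<exists>B. \<forall>x\<in>X. L2_set (\<gamma> x) {..<m} \<le> B)"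

definition expectations ::
  "'x set \<Rightarrow> (('x \<Rightarrow> real) \<Rightarrow> real) set \<Rightarrow> nat \<Rightarrow> ('x \<Rightarrow> nat \<Rightarrow> real) \<Rightarrow> (nat \<Rightarrow> real) set" where
  "expectations X P m \<gamma> = (\<lambda>p i. if i < m then p (\<lambda>x\<in>X. \<gamma> x i) else 0) ` P"


section \<open>Nets\<close>

text \<open>\<open>le a b\<close> is to be read as \<open>b \<ge> a\<close>.\<close>

definition directed_set :: "'i set \<Rightarrow> ('i \<Rightarrow> 'i \<Rightarrow> bool) \<Rightarrow> bool" where
  "directed_set \<Lambda> le \<longleftrightarrow> \<Lambda> \<noteq> {} \<and> reflp_on \<Lambda> le \<and> transp_on \<Lambda> le \<and>
     (\<forall>a\<in>\<Lambda>. \<forall>b\<in>\<Lambda>. \<exists>c\<in>\<Lambda>. le a c \<and> le b c)"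

definition net_limit_points ::
  "'a topology \<Rightarrow> 'i set \<Rightarrow> ('i \<Rightarrow> 'i \<Rightarrow> bool) \<Rightarrow> ('i \<Rightarrow> 'a) \<Rightarrow> 'a set" where
  "net_limit_points T \<Lambda> le g = {x \<in> topspace T.
     \<forall>V. openin T V \<and> x \<in> V \<longrightarrow> (\<forall>a\<in>\<Lambda>. \<exists>b\<in>\<Lambda>. le a b \<and> g b \<in> V)}"

record ('i, 'x) sampling_net =
  idx :: "'i set"
  idx_le :: "'i \<Rightarrow> 'i \<Rightarrow> bool"
  sample :: "'i \<Rightarrow> 'x list"

text \<open>The disjoint union of the sets of \<open>n\<close>-tuples, \<open>n \<ge> 1\<close>, is the set of non-empty lists.\<close>

definition tuples :: "'x set \<Rightarrow> 'x list set" where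
  "tuples X = lists X - {[]}"

definition sampling_nets :: "'x set \<Rightarrow> ('i, 'x) sampling_net set" where
  "sampling_nets X = {\<phi>. directed_set (idx \<phi>) (idx_le \<phi>) \<and> sample \<phi> \<in> idx \<phi> \<rightarrow> tuples X}"

definition list_average :: "('x \<Rightarrow> real) \<Rightarrow> 'x list \<Rightarrow> real" where
  "list_average f xs = (\<Sum>x\<leftarrow>xs. f x) / real (length xs)"

text \<open>
  The empirical measure of a tuple as a functional, that is, integration with respect to it.
  The lemmas \<open>empirical_in_PF\<close> and \<open>empirical_unique\<close> below show that this is the one element of \<open>PF X\<close> whose value
  on each \<open>A \<subseteq> X\<close> is the relative frequency of \<open>A\<close> in the tuple.
\<close>

definition empirical :: "'x set \<Rightarrow> 'x list \<Rightarrow> ('x \<Rightarrow> real) \<Rightarrow> real" where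
  "empirical X xs = (\<lambda>f\<in>bounded_functions X. list_average f xs)"

lemma list_average_restrict:
  assumes "xs \<in> tuples X"
  shows "list_average (restrict f X) xs = list_average f xs"
proof -
  have "map (restrict f X) xs = map f xs"
    using assms by (auto simp: tuples_def)
  then show ?thesis
    unfolding list_average_def by metis
qed

lemma list_average_add: "list_average (\<lambda>x. f x + g x) xs = list_average f xs + list_average g xs"
  by (simp add: list_average_def sum_list_addf add_divide_distrib)

lemma list_average_scale: "list_average (\<lambda>x. c * f x) xs = c * list_average f xs"
  by (simp add: list_average_def sum_list_const_mult)

lemma char_fun_bounded: "char_fun X A \<in> bounded_functions X"
  unfolding bounded_functions_def char_fun_def
  by (auto simp: bounded_iff intro!: exI[of _ 1] split: split_indicator)

lemma empirical_in_PF: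
  assumes "xs \<in> tuples X"
  shows "empirical X xs \<in> PF X"
    and "empirical X xs (char_fun X A) = list_average (indicat_real A) xs"
proof -
  have sub: "set xs \<subseteq> X" and ne: "length xs > 0"
    using assms by (auto simp: tuples_def)
  have add: "(\<lambda>x\<in>X. f x + g x) \<in> bounded_functions X"
    if "f \<in> bounded_functions X" "g \<in> bounded_functions X" for f g
    using that bounded_plus_comp[of f X g] by (auto simp: bounded_functions_def)
  have scale: "(\<lambda>x\<in>X. c * f x) \<in> bounded_functions X" if "f \<in> bounded_functions X" for c f
    using that bounded_scaling[of "f ` X" c] by (auto simp: bounded_functions_def image_image)
  have bnd: "\<bar>list_average f xs\<bar> \<le> sup_norm X f" if f: "f \<in> bounded_functions X" for f
  proof -
    have bdd: "bdd_above ((\<lambda>x. \<bar>f x\<bar>) ` X)"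
      using f by (auto simp: bounded_functions_def bounded_iff bdd_above_def)
    have "\<bar>\<Sum>x\<leftarrow>xs. f x\<bar> \<le> (\<Sum>x\<leftarrow>xs. \<bar>f x\<bar>)"
      using sum_list_abs[of "map f xs"] by (simp add: comp_def)
    also have "\<dots> \<le> (\<Sum>x\<leftarrow>xs. sup_norm X f)"
      using sub bdd by (intro sum_list_mono) (auto simp: sup_norm_def intro: cSUP_upper)
    also have "\<dots> = real (length xs) * sup_norm X f"
      by (simp add: sum_list_triv)
    finally show ?thesis
      using ne by (simp add: list_average_def abs_divide field_simps)
  qed
  have "empirical X xs \<in> dual_space X"
    unfolding dual_space_def
  proof (intro CollectI conjI ballI allI)
    show "empirical X xs \<in> extensional (bounded_functions X)"
      by (simp add: empirical_def)
    show "empirical X xs (\<lambda>x\<in>X. f x + g x) = empirical X xs f + empirical X xs g"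
      if "f \<in> bounded_functions X" "g \<in> bounded_functions X" for f g
      using that add[OF that] list_average_restrict[OF assms]
      by (simp add: empirical_def list_average_add)
    show "empirical X xs (\<lambda>x\<in>X. c * f x) = c * empirical X xs f"
      if "f \<in> bounded_functions X" for c f
      using that scale[OF that] list_average_restrict[OF assms]
      by (simp add: empirical_def list_average_scale)
    show "\<exists>C. \<forall>f\<in>bounded_functions X. \<bar>empirical X xs f\<bar> \<le> C * sup_norm X f"
      using bnd by (intro exI[of _ 1]) (simp add: empirical_def)
  qed
  moreover have "0 \<le> empirical X xs f" if "f \<in> bounded_functions X" "\<forall>x\<in>X. 0 \<le> f x" for f
  proof -
    have "0 \<le> (\<Sum>x\<leftarrow>xs. f x)"
      using that sub by (intro sum_list_nonneg) auto
    then show ?thesis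
      using that by (simp add: empirical_def list_average_def)
  qed
  moreover show val: "empirical X xs (char_fun X A) = list_average (indicat_real A) xs" for A
    using char_fun_bounded[of X A] list_average_restrict[OF assms]
    by (simp add: empirical_def char_fun_def)
  moreover have "list_average (indicat_real X) xs = 1"
  proof -
    have "map (indicat_real X) xs = map (\<lambda>_. 1) xs"
      using sub by (auto simp: indicator_def)
    then have "(\<Sum>x\<leftarrow>xs. indicat_real X x) = (\<Sum>x\<leftarrow>xs. 1)"
      by metis
    then show ?thesis
      using ne by (simp add: list_average_def sum_list_triv)
  qed
  ultimately show "empirical X xs \<in> PF X"
    by (auto simp: PF_def)
qed

lemma empirical_unique:
  assumes xs: "xs \<in> tuples X" and p: "p \<in> PF X"
    and val: "\<And>A. A \<subseteq> X \<Longrightarrow> p (char_fun X A) = list_average (indicat_real A) xs"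
  shows "p = empirical X xs"
proof (rule extensionalityI[of _ "bounded_functions X"])
  show "p \<in> extensional (bounded_functions X)"
    using p by (simp add: PF_def dual_space_def)
  show "empirical X xs \<in> extensional (bounded_functions X)"
    by (simp add: empirical_def)
  fix f assume f: "f \<in> bounded_functions X"
  have sub: "set xs \<subseteq> X"
    using xs by (auto simp: tuples_def)
  obtain B where B: "\<And>x. x \<in> X \<Longrightarrow> \<bar>f x\<bar> \<le> B"
    using f by (auto simp: bounded_functions_def bounded_iff)
  have add: "p (\<lambda>x\<in>X. f x + g x) = p f + p g"
    if "f \<in> bounded_functions X" "g \<in> bounded_functions X" for f g
    using p that by (auto simp: PF_def dual_space_def)
  have scale: "p (\<lambda>x\<in>X. c * f x) = c * p f" if "f \<in> bounded_functions X" for c f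
    using p that by (auto simp: PF_def dual_space_def)
  have pos: "0 \<le> p f" if "f \<in> bounded_functions X" "\<And>x. x \<in> X \<Longrightarrow> 0 \<le> f x" for f
    using p that by (auto simp: PF_def)
  have add_bd: "(\<lambda>x\<in>X. f x + g x) \<in> bounded_functions X"
    if "f \<in> bounded_functions X" "g \<in> bounded_functions X" for f g
    using that bounded_plus_comp[of f X g] by (auto simp: bounded_functions_def)
  have scale_bd: "(\<lambda>x\<in>X. c * f x) \<in> bounded_functions X" if "f \<in> bounded_functions X" for c f
    using that bounded_scaling[of "f ` X" c] by (auto simp: bounded_functions_def image_image)
  define h where "h S = (\<lambda>x\<in>X. if x \<in> S then f x else 0)" for S
  have h_bd: "h S \<in> bounded_functions X" for S
    using B by (auto simp: h_def bounded_functions_def bounded_iff intro!: exI[of _ "\<bar>B\<bar>"])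
      fastforce+
  have on_finite: "p (h S) = list_average (h S) xs" if "finite S" "S \<subseteq> X" for S
    using that
  proof (induction S)
    case empty
    have "h {} = (\<lambda>x\<in>X. 0 * f x)"
      by (auto simp: h_def)
    then have "p (h {}) = 0"
      using scale[OF f, of 0] by simp
    moreover have "list_average (h {}) xs = 0"
      using list_average_restrict[OF xs, of "\<lambda>x. 0"]
      by (simp add: h_def list_average_def)
    ultimately show ?case by simp
  next
    case (insert a S)
    let ?g = "\<lambda>x\<in>X. f a * char_fun X {a} x"
    have g: "?g \<in> bounded_functions X"
      by (rule scale_bd[OF char_fun_bounded])
    have eq: "h (insert a S) = (\<lambda>x\<in>X. ?g x + h S x)"
      using insert by (auto simp: h_def char_fun_def fun_eq_iff restrict_def indicator_def)
    have "p (h (insert a S)) = f a * list_average (indicat_real {a}) xs + list_average (h S) xs"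
      using insert by (simp only: eq add[OF g h_bd] scale[OF char_fun_bounded]) (simp add: val)
    also have "f a * list_average (indicat_real {a}) xs = list_average ?g xs"
      by (simp only: list_average_restrict[OF xs] list_average_scale char_fun_def)
    also have "\<dots> + list_average (h S) xs = list_average (\<lambda>x. ?g x + h S x) xs"
      by (rule list_average_add[symmetric])
    also have "\<dots> = list_average (h (insert a S)) xs"
      unfolding eq by (rule list_average_restrict[OF xs, symmetric])
    finally show ?case .
  qed
  let ?r = "h (- set xs)"
  have f_eq: "f = (\<lambda>x\<in>X. h (set xs) x + ?r x)"
    using f by (auto simp: h_def bounded_functions_def extensional_def fun_eq_iff)
  have zero: "p (char_fun X (X - set xs)) = 0"
  proof -
    have "(\<Sum>x\<leftarrow>xs. indicat_real (X - set xs) x) = (\<Sum>x\<leftarrow>xs. 0)"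
      by (rule arg_cong[of _ _ sum_list]) auto
    then show ?thesis
      by (simp add: val list_average_def)
  qed
  have small: "0 \<le> c * p ?r" if c: "\<bar>c\<bar> = 1" for c
  proof -
    let ?b = "\<lambda>x\<in>X. B * char_fun X (X - set xs) x" and ?s = "\<lambda>x\<in>X. c * ?r x"
    have b: "?b \<in> bounded_functions X" and s: "?s \<in> bounded_functions X"
      by (rule scale_bd[OF char_fun_bounded], rule scale_bd[OF h_bd])
    have "0 \<le> p (\<lambda>x\<in>X. ?b x + ?s x)"
    proof (rule pos[OF add_bd[OF b s]])
      fix x assume x: "x \<in> X"
      have "\<bar>c * f x\<bar> \<le> B"
        using B[OF x] c by (simp add: abs_mult)
      then show "0 \<le> (\<lambda>x\<in>X. ?b x + ?s x) x"
        using x by (auto simp: h_def char_fun_def)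
    qed
    then show ?thesis
      by (simp only: add[OF b s] scale[OF char_fun_bounded] scale[OF h_bd] zero)
  qed
  have "p ?r = 0"
    using small[of 1] small[of "-1"] by simp
  then have "p f = p (h (set xs))"
    using add[OF h_bd[of "set xs"] h_bd[of "- set xs"]] f_eq by simp
  also have "\<dots> = list_average (h (set xs)) xs"
    using sub by (simp add: on_finite)
  also have "\<dots> = list_average f xs"
  proof -
    have "map (h (set xs)) xs = map f xs"
      using sub by (auto simp: h_def)
    then show ?thesis
      unfolding list_average_def by metis
  qed
  also have "\<dots> = empirical X xs f"
    using f by (simp add: empirical_def)
  finally show "p f = empirical X xs f" .
qed

definition net_regularity :: "'x set \<Rightarrow> ('i, 'x) sampling_net \<Rightarrow> (('x \<Rightarrow> real) \<Rightarrow> real) set" where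
  "net_regularity X \<phi> =
     net_limit_points (PF_topology X) (idx \<phi>) (idx_le \<phi>) (\<lambda>l. empirical X (sample \<phi> l))"

definition average_limit_points ::
  "('i, 'x) sampling_net \<Rightarrow> nat \<Rightarrow> ('x \<Rightarrow> nat \<Rightarrow> real) \<Rightarrow> (nat \<Rightarrow> real) set" where
  "average_limit_points \<phi> m \<gamma> =
     net_limit_points (Euclidean_space m) (idx \<phi>) (idx_le \<phi>)
       (\<lambda>l i. list_average (\<lambda>x. \<gamma> x i) (sample \<phi> l))"

definition S_equivalent ::
  "'x set \<Rightarrow> ('i, 'x) sampling_net \<Rightarrow> ('j, 'x) sampling_net \<Rightarrow> bool" where
  "S_equivalent X \<phi> \<psi> \<longleftrightarrow>
     (\<forall>m \<gamma>. bounded_map X m \<gamma> \<longrightarrow> average_limit_points \<phi> m \<gamma> = average_limit_points \<psi> m \<gamma>)"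

definition S_equivalence :: "'x set \<Rightarrow> ('i, 'x) sampling_net rel" where
  "S_equivalence X =
     {(\<phi>, \<psi>). \<phi> \<in> sampling_nets X \<and> \<psi> \<in> sampling_nets X \<and> S_equivalent X \<phi> \<psi>}"

text \<open>
  The sampling nets over arbitrary directed sets form a proper class, and the index type of an
  existentially quantified net has to be a fixed type. The following type is large enough: its
  subsets can index a sampling net with any given regularity.
\<close>

type_synonym 'x large_index = "('x \<Rightarrow> real) set \<times> nat \<times> 'x list"

end

theory Submission
  imports Defs
begin

text \<open>
  Two facts about \<open>PF X\<close> with the weak-star topology carry the proof: it is compact, and the
  empirical measures of tuples are dense in it.

  The averages of \<open>\<gamma>\<close> along a sampling net are the images of the empirical measures under the map
  \<open>p \<mapsto> (p(\<gamma>\<^sub>1), \<dots>, p(\<gamma>\<^sub>m))\<close>, which is continuous into a Hausdorff space. A continuous map always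
  sends limit points to limit points; since \<open>PF X\<close> is compact, every limit point of the image net
  arises in this way (\<open>net_limit_points_continuous_image\<close>). This gives the formula for the limit
  points of the averages, and mapping to a single point shows that \<open>P\<^sub>\<phi>\<close> is not empty. Sets of limit
  points are closed, so \<open>P\<^sub>\<phi>\<close> is a regularity.

  By this formula, the S-equivalence class of \<open>\<phi>\<close> knows exactly the sets \<open>P\<^sub>\<phi>(\<gamma>)\<close>, and these determine
  the closed set \<open>P\<^sub>\<phi>\<close> because a basic weak-star neighbourhood involves only finitely many functions
  (\<open>subset_if_expectations_subset\<close>).

  For surjectivity, a given closed set \<open>P\<close> is approximated by all tuples whose empirical measures are
  close to some element of \<open>P\<close> on a finite set of functions, with the set growing and the tolerance
  shrinking (\<open>regularity_has_sampling_net\<close>). Density provides such tuples near each element of \<open>P\<close>; it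
  holds because a finite partition of \<open>X\<close> into sets on which the given functions are nearly constant
  reduces \<open>p\<close> to a finite convex combination of point evaluations, and weights can be rounded to
  multiplicities (\<open>empirical_close_on\<close>).
\<close>

section \<open>Limit points of nets\<close>

lemma net_limit_points_cong:
  assumes "\<And>l. l \<in> \<Lambda> \<Longrightarrow> g l = h l"
  shows "net_limit_points T \<Lambda> le g = net_limit_points T \<Lambda> le h"
  using assms by (simp add: net_limit_points_def cong: conj_cong)

lemma closedin_net_limit_points: "closedin T (net_limit_points T \<Lambda> le g)"
proof -
  have "openin T (topspace T - net_limit_points T \<Lambda> le g)"
  proof (subst openin_subopen, intro ballI)
    fix x assume "x \<in> topspace T - net_limit_points T \<Lambda> le g"
    then obtain V a where V: "openin T V" "x \<in> V" "a \<in> \<Lambda>" "\<And>b. b \<in> \<Lambda> \<Longrightarrow> le a b \<Longrightarrow> g b \<notin> V"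
      by (auto simp: net_limit_points_def)
    then have "V \<subseteq> topspace T - net_limit_points T \<Lambda> le g"
      using openin_subset[OF V(1)] by (fastforce simp: net_limit_points_def)
    with V show "\<exists>W. openin T W \<and> x \<in> W \<and> W \<subseteq> topspace T - net_limit_points T \<Lambda> le g"
      by blast
  qed
  then show ?thesis
    by (auto simp: closedin_def net_limit_points_def)
qed

text \<open>
  Compactness is what allows limit points of the image net to be lifted. If \<open>y\<close> were not the image of a
  limit point, every point of the space would have a neighbourhood \<open>U\<close> that the net eventually
  avoids at those indices where its image is close to \<open>y\<close>: near a point that is not a limit
  point the net itself stays away, and near a point with image different from \<open>y\<close> the Hausdorff
  property applies. Finite unions of such \<open>U\<close> have the same property, so the whole space would
  have it, and \<open>y\<close> would not be a limit point.
\<close>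

lemma net_limit_points_continuous_image:
  assumes comp: "compact_space T" and haus: "Hausdorff_space T'" and cont: "continuous_map T T' e"
    and dir: "directed_set \<Lambda> le" and g: "g \<in> \<Lambda> \<rightarrow> topspace T"
  shows "net_limit_points T' \<Lambda> le (\<lambda>l. e (g l)) = e ` net_limit_points T \<Lambda> le g"
proof (intro equalityI subsetI)
  fix y assume "y \<in> e ` net_limit_points T \<Lambda> le g"
  then obtain p where p: "p \<in> net_limit_points T \<Lambda> le g" "y = e p"
    by blast
  have "\<exists>b\<in>\<Lambda>. le a b \<and> e (g b) \<in> V" if V: "openin T' V" "e p \<in> V" and a: "a \<in> \<Lambda>" for V a
  proof -
    have "openin T {x \<in> topspace T. e x \<in> V}"
      using cont V(1) by (rule openin_continuous_map_preimage)
    then show ?thesis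
      using p(1) V a by (fastforce simp: net_limit_points_def)
  qed
  then show "y \<in> net_limit_points T' \<Lambda> le (\<lambda>l. e (g l))"
    using p continuous_map_image_subset_topspace[OF cont] by (auto simp: net_limit_points_def)
next
  fix y assume y: "y \<in> net_limit_points T' \<Lambda> le (\<lambda>l. e (g l))"
  define avoided where "avoided U \<longleftrightarrow> (\<exists>V a. openin T' V \<and> y \<in> V \<and> a \<in> \<Lambda> \<and>
    (\<forall>b\<in>\<Lambda>. le a b \<longrightarrow> e (g b) \<in> V \<longrightarrow> g b \<notin> U))" for U
  have ytop: "y \<in> topspace T'"
    using y by (simp add: net_limit_points_def)
  have avoided_Union: "avoided (\<Union>\<F>)" if "finite \<F>" "\<forall>U\<in>\<F>. avoided U" for \<F>
    using that
  proof (induction \<F>)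
    case empty
    then show ?case
      using dir ytop openin_topspace[of T'] unfolding avoided_def directed_set_def by auto
  next
    case (insert U \<F>)
    then obtain V a V' a' where
      1: "openin T' V" "y \<in> V" "a \<in> \<Lambda>" "\<forall>b\<in>\<Lambda>. le a b \<longrightarrow> e (g b) \<in> V \<longrightarrow> g b \<notin> U" and
      2: "openin T' V'" "y \<in> V'" "a' \<in> \<Lambda>" "\<forall>b\<in>\<Lambda>. le a' b \<longrightarrow> e (g b) \<in> V' \<longrightarrow> g b \<notin> \<Union>\<F>"
      unfolding avoided_def by (metis insert_iff)
    obtain c where c: "c \<in> \<Lambda>" "le a c" "le a' c"
      using dir 1 2 unfolding directed_set_def by blast
    have "le a b \<and> le a' b" if "b \<in> \<Lambda>" "le c b" for b
      using that c 1 2 dir unfolding directed_set_def transp_on_def by blast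
    then have "\<forall>b\<in>\<Lambda>. le c b \<longrightarrow> e (g b) \<in> V \<inter> V' \<longrightarrow> g b \<notin> \<Union>(insert U \<F>)"
      using 1 2 by blast
    moreover have "openin T' (V \<inter> V')" "y \<in> V \<inter> V'"
      using 1 2 by auto
    ultimately show ?case
      using c(1) unfolding avoided_def by blast
  qed
  show "y \<in> e ` net_limit_points T \<Lambda> le g"
  proof (rule ccontr)
    assume not: "y \<notin> e ` net_limit_points T \<Lambda> le g"
    have local: "\<exists>U. openin T U \<and> avoided U \<and> p \<in> U" if p: "p \<in> topspace T" for p
    proof (cases "p \<in> net_limit_points T \<Lambda> le g")
      case False
      then obtain U a where "openin T U" "p \<in> U" "a \<in> \<Lambda>" "\<And>b. b \<in> \<Lambda> \<Longrightarrow> le a b \<Longrightarrow> g b \<notin> U"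
        using p by (auto simp: net_limit_points_def)
      moreover from this have "avoided U"
        using ytop unfolding avoided_def by blast
      ultimately show ?thesis
        by blast
    next
      case True
      then have "e p \<noteq> y" "e p \<in> topspace T'"
        using not p continuous_map_image_subset_topspace[OF cont] by auto
      then obtain W V where W: "openin T' W" "openin T' V" "e p \<in> W" "y \<in> V" "disjnt W V"
        using haus ytop unfolding Hausdorff_space_def by blast
      let ?U = "{x \<in> topspace T. e x \<in> W}"
      have "openin T ?U"
        using cont W(1) by (rule openin_continuous_map_preimage)
      moreover have "avoided ?U"
        using W dir unfolding avoided_def directed_set_def disjnt_def by blast
      ultimately show ?thesis
        using p W by blast
    qed
    then have "topspace T \<subseteq> \<Union>{U. openin T U \<and> avoided U}"
      by blast
    then obtain \<F> where \<F>: "finite \<F>" "\<F> \<subseteq> {U. openin T U \<and> avoided U}" "topspace T \<subseteq> \<Union>\<F>"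
      using comp unfolding compact_space_alt by (metis (no_types, lifting) mem_Collect_eq)
    then have "avoided (\<Union>\<F>)"
      by (intro avoided_Union) auto
    then obtain V a where V: "openin T' V" "y \<in> V" "a \<in> \<Lambda>"
        "\<forall>b\<in>\<Lambda>. le a b \<longrightarrow> e (g b) \<in> V \<longrightarrow> g b \<notin> \<Union>\<F>"
      unfolding avoided_def by metis
    have "\<exists>b\<in>\<Lambda>. le a b \<and> e (g b) \<in> V"
      using y V(1-3) by (simp add: net_limit_points_def)
    then obtain b where b: "b \<in> \<Lambda>" "le a b" "e (g b) \<in> V"
      by blast
    then have "g b \<notin> \<Union>\<F>"
      using V(4) by simp
    moreover have "g b \<in> topspace T"
      using g b(1) by blast
    ultimately show False
      using \<F>(3) by blast
  qed
qed

text \<open>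
  Mapping the whole space to a single point turns the lifting of limit points into their existence.
\<close>

lemma net_limit_points_nonempty:
  assumes "compact_space T" and dir: "directed_set \<Lambda> le" and "g \<in> \<Lambda> \<rightarrow> topspace T"
  shows "net_limit_points T \<Lambda> le g \<noteq> {}"
proof -
  have "net_limit_points (discrete_topology {()}) \<Lambda> le (\<lambda>l. ()) = (\<lambda>_. ()) ` net_limit_points T \<Lambda> le g"
    by (rule net_limit_points_continuous_image) (use assms in auto)
  moreover have "() \<in> net_limit_points (discrete_topology {()}) \<Lambda> le (\<lambda>l. ())"
    using dir by (auto simp: net_limit_points_def directed_set_def reflp_on_def)
  ultimately show ?thesis
    by blast
qed

section \<open>The compact space of finitely additive probabilities\<close>

lemma restrict_bounded_functions_iff: "restrict f X \<in> bounded_functions X \<longleftrightarrow> bounded (f ` X)"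
proof -
  have "restrict f X ` X = f ` X"
    by (rule image_cong) auto
  then show ?thesis
    by (simp add: bounded_functions_def)
qed

lemma bounded_functionsD:
  assumes "f \<in> bounded_functions X"
  shows "restrict f X = f" "bounded (f ` X)"
  using assms by (auto simp: bounded_functions_def extensional_restrict)

lemma bounded_functions_add:
  assumes "f \<in> bounded_functions X" "g \<in> bounded_functions X"
  shows "(\<lambda>x\<in>X. f x + g x) \<in> bounded_functions X"
  using assms bounded_plus_comp[of f X g]
  by (simp add: restrict_bounded_functions_iff bounded_functionsD)

lemma bounded_functions_scale:
  assumes "f \<in> bounded_functions X"
  shows "(\<lambda>x\<in>X. c * f x) \<in> bounded_functions X"
  using bounded_functionsD(2)[OF assms] bounded_scaling[of "f ` X" c]
  by (simp add: restrict_bounded_functions_iff image_image)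

lemma bounded_functions_abs_le_sup_norm:
  assumes "f \<in> bounded_functions X" "x \<in> X"
  shows "\<bar>f x\<bar> \<le> sup_norm X f"
proof -
  have "bdd_above ((\<lambda>x. \<bar>f x\<bar>) ` X)"
    using assms(1) by (auto simp: bounded_functions_def bounded_iff bdd_above_def)
  then show ?thesis
    using assms(2) by (auto simp: sup_norm_def intro: cSUP_upper)
qed

text \<open>
  Positivity and normalisation give the bound by the sup norm. This places \<open>PF X\<close> inside a product
  of compact intervals, from which it is cut out by equations and weak inequalities between finitely
  many evaluations, hence by closed conditions.
\<close>

lemma positive_functional_abs_le:
  assumes add: "\<And>f g. f \<in> bounded_functions X \<Longrightarrow> g \<in> bounded_functions X \<Longrightarrow>
      p (\<lambda>x\<in>X. f x + g x) = p f + p g"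
    and scale: "\<And>c f. f \<in> bounded_functions X \<Longrightarrow> p (\<lambda>x\<in>X. c * f x) = c * p f"
    and pos: "\<And>f. f \<in> bounded_functions X \<Longrightarrow> (\<And>x. x \<in> X \<Longrightarrow> 0 \<le> f x) \<Longrightarrow> 0 \<le> p f"
    and one: "p (char_fun X X) = (1::real)"
    and f: "f \<in> bounded_functions X" and B: "\<And>x. x \<in> X \<Longrightarrow> \<bar>f x\<bar> \<le> B"
  shows "\<bar>p f\<bar> \<le> B"
proof -
  let ?b = "\<lambda>x\<in>X. B * char_fun X X x"
  have b: "?b \<in> bounded_functions X"
    by (rule bounded_functions_scale[OF char_fun_bounded])
  \<comment> \<open>Positivity is applied to \<open>B + f\<close> and to \<open>B - f\<close>.\<close>
  have "0 \<le> B + c * p f" if c: "\<bar>c\<bar> = 1" for c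
  proof -
    let ?s = "\<lambda>x\<in>X. c * f x"
    have s: "?s \<in> bounded_functions X"
      by (rule bounded_functions_scale[OF f])
    have "0 \<le> p (\<lambda>x\<in>X. ?b x + ?s x)"
    proof (rule pos[OF bounded_functions_add[OF b s]])
      fix x assume x: "x \<in> X"
      have "\<bar>c * f x\<bar> \<le> B"
        using B[OF x] c by (simp add: abs_mult)
      then show "0 \<le> (\<lambda>x\<in>X. ?b x + ?s x) x"
        using x by (simp add: char_fun_def)
    qed
    then show ?thesis
      by (simp only: add[OF b s] scale[OF char_fun_bounded] scale[OF f] one)
  qed
  from this[of 1] this[of "-1"] show ?thesis
    by simp
qed

lemma PF_add:
  "p \<in> PF X \<Longrightarrow> f \<in> bounded_functions X \<Longrightarrow> g \<in> bounded_functions X \<Longrightarrow>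
    p (\<lambda>x\<in>X. f x + g x) = p f + p g"
  by (simp add: PF_def dual_space_def)

lemma PF_scale:
  "p \<in> PF X \<Longrightarrow> f \<in> bounded_functions X \<Longrightarrow> p (\<lambda>x\<in>X. c * f x) = c * p f"
  by (simp add: PF_def dual_space_def)

lemma PF_nonneg:
  "p \<in> PF X \<Longrightarrow> f \<in> bounded_functions X \<Longrightarrow> (\<And>x. x \<in> X \<Longrightarrow> 0 \<le> f x) \<Longrightarrow> 0 \<le> p f"
  by (simp add: PF_def)

lemma PF_char_fun_X: "p \<in> PF X \<Longrightarrow> p (char_fun X X) = 1"
  by (simp add: PF_def)

lemma PF_abs_le:
  assumes "p \<in> PF X" "f \<in> bounded_functions X" "\<And>x. x \<in> X \<Longrightarrow> \<bar>f x\<bar> \<le> B"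
  shows "\<bar>p f\<bar> \<le> B"
  by (rule positive_functional_abs_le[of X p])
    (use assms in \<open>auto simp: PF_add PF_scale PF_char_fun_X PF_nonneg\<close>)

lemma PF_iff:
  "p \<in> PF X \<longleftrightarrow> p \<in> (\<Pi>\<^sub>E f\<in>bounded_functions X. {- sup_norm X f..sup_norm X f}) \<and>
     (\<forall>f\<in>bounded_functions X. \<forall>g\<in>bounded_functions X. p (\<lambda>x\<in>X. f x + g x) = p f + p g) \<and>
     (\<forall>c. \<forall>f\<in>bounded_functions X. p (\<lambda>x\<in>X. c * f x) = c * p f) \<and>
     (\<forall>f\<in>bounded_functions X. (\<forall>x\<in>X. 0 \<le> f x) \<longrightarrow> p f \<in> {0..}) \<and> p (char_fun X X) = 1"
  (is "_ \<longleftrightarrow> ?R")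
proof
  assume p: "p \<in> PF X"
  have "\<bar>p f\<bar> \<le> sup_norm X f" if "f \<in> bounded_functions X" for f
    using p that by (rule PF_abs_le) (simp add: bounded_functions_abs_le_sup_norm that)
  then have "p \<in> (\<Pi>\<^sub>E f\<in>bounded_functions X. {- sup_norm X f..sup_norm X f})"
    using p by (auto simp: PF_def dual_space_def PiE_def abs_le_iff minus_le_iff)
  then show ?R
    using p by (auto simp: PF_def dual_space_def)
next
  assume R: ?R
  have "\<bar>p f\<bar> \<le> 1 * sup_norm X f" if "f \<in> bounded_functions X" for f
    using PiE_mem[OF conjunct1[OF R] that] by auto
  then have "\<exists>C. \<forall>f\<in>bounded_functions X. \<bar>p f\<bar> \<le> C * sup_norm X f"
    by blast
  then show "p \<in> PF X"
    using R unfolding PF_def dual_space_def PiE_def by simp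
qed

lemma PF_topology_eq:
  "PF_topology X =
     subtopology (product_topology (\<lambda>_. euclideanreal) (bounded_functions X)) (PF X)"
proof -
  have "dual_space X \<inter> PF X = PF X"
    by (auto simp: PF_def)
  then show ?thesis
    by (simp add: PF_topology_def weak_star_topology_def subtopology_subtopology)
qed

lemma topspace_PF_topology: "topspace (PF_topology X) = PF X"
  by (auto simp: PF_topology_eq PF_def dual_space_def PiE_def)

lemma continuous_map_evaluation:
  "f \<in> bounded_functions X \<Longrightarrow> continuous_map (PF_topology X) euclideanreal (\<lambda>p. p f)"
  unfolding PF_topology_eq
  by (intro continuous_map_from_subtopology continuous_map_product_projection)

text \<open>
  A closed subset of a product of compact intervals is compact (Banach--Alaoglu for this set).
\<close>

lemma compact_space_PF_topology: "compact_space (PF_topology X)"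
proof -
  let ?B = "bounded_functions X" and ?T = "product_topology (\<lambda>_. euclideanreal) (bounded_functions X)"
  let ?box = "\<Pi>\<^sub>E f\<in>?B. {- sup_norm X f..sup_norm X f}"
  have ev: "continuous_map ?T euclideanreal (\<lambda>p. p f)" if "f \<in> ?B" for f
    using that by (rule continuous_map_product_projection)
  define E where "E =
    (\<lambda>(f, g). {p \<in> topspace ?T. p (\<lambda>x\<in>X. f x + g x) = p f + p g}) ` (?B \<times> ?B) \<union>
    (\<lambda>(c, f). {p \<in> topspace ?T. p (\<lambda>x\<in>X. c * f x) = c * p f}) ` (UNIV \<times> ?B) \<union>
    (\<lambda>f. {p \<in> topspace ?T. p f \<in> {0..}}) ` {f \<in> ?B. \<forall>x\<in>X. 0 \<le> f x} \<union>
    {{p \<in> topspace ?T. p (char_fun X X) = 1}}"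
  have "closedin ?T (\<Inter>E)"
  proof (rule closedin_Inter)
    fix S assume S: "S \<in> E"
    have add: "closedin ?T {p \<in> topspace ?T. p (\<lambda>x\<in>X. f x + g x) = p f + p g}"
      if "f \<in> ?B" "g \<in> ?B" for f g
      by (rule closedin_continuous_maps_eq[where Y = euclideanreal])
        (use that in \<open>auto intro!: continuous_map_add ev bounded_functions_add\<close>)
    have scale: "closedin ?T {p \<in> topspace ?T. p (\<lambda>x\<in>X. c * f x) = c * p f}"
      if "f \<in> ?B" for c f
      by (rule closedin_continuous_maps_eq[where Y = euclideanreal])
        (use that in \<open>auto intro!: continuous_map_real_mult_left ev bounded_functions_scale\<close>)
    have pos: "closedin ?T {p \<in> topspace ?T. p f \<in> {0..}}" if "f \<in> ?B" for f
      by (rule closedin_continuous_map_preimage[OF ev[OF that]]) simp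
    have one: "closedin ?T {p \<in> topspace ?T. p (char_fun X X) = 1}"
      by (rule closedin_continuous_maps_eq[where Y = euclideanreal])
        (auto intro!: ev char_fun_bounded)
    from S show "closedin ?T S"
      unfolding E_def by (elim UnE imageE) (auto simp: add scale pos one simp del: topspace_product_topology atLeast_iff)
  qed (auto simp: E_def)
  moreover have "compactin ?T ?box"
    by (simp add: compactin_PiE)
  moreover have "PF X = ?box \<inter> \<Inter>E"
  proof -
    have "p \<in> PF X \<longleftrightarrow> p \<in> ?box \<and> (\<forall>S\<in>E. p \<in> S)" for p
    proof (cases "p \<in> topspace ?T")
      case True
      then show ?thesis
        unfolding PF_iff E_def by (simp add: ball_Un) (intro iffI conjI; elim conjE; simp)
    next
      case False
      then show ?thesis
        unfolding PF_iff by (auto simp: PiE_def)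
    qed
    then show ?thesis
      by blast
  qed
  ultimately have "compactin ?T (PF X)"
    by (simp add: compact_Int_closedin)
  then show ?thesis
    unfolding PF_topology_eq by (simp add: compact_space_subtopology)
qed

text \<open>
  The next two lemmas say that closeness on finitely many functions, with one tolerance for all of
  them, gives a neighbourhood base.
\<close>

lemma openin_PF_close_on:
  assumes "finite F" "F \<subseteq> bounded_functions X"
  shows "openin (PF_topology X) {q \<in> PF X. \<forall>f\<in>F. \<bar>q f - p f\<bar> < e}"
  using assms
proof (induction F)
  case empty
  show ?case
    using openin_topspace[of "PF_topology X"] by (simp add: topspace_PF_topology)
next
  case (insert f F)
  have "openin (PF_topology X) {q \<in> topspace (PF_topology X). q f \<in> {p f - e<..<p f + e}}"
    by (rule openin_continuous_map_preimage[OF continuous_map_evaluation]) (use insert in auto)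
  then have "openin (PF_topology X) ({q \<in> topspace (PF_topology X). q f \<in> {p f - e<..<p f + e}}
      \<inter> {q \<in> PF X. \<forall>f\<in>F. \<bar>q f - p f\<bar> < e})"
    using insert by (intro openin_Int) auto
  moreover have "{q \<in> topspace (PF_topology X). q f \<in> {p f - e<..<p f + e}}
      \<inter> {q \<in> PF X. \<forall>f\<in>F. \<bar>q f - p f\<bar> < e} = {q \<in> PF X. \<forall>f\<in>insert f F. \<bar>q f - p f\<bar> < e}"
    by (auto simp: topspace_PF_topology abs_less_iff)
  ultimately show ?case
    by simp
qed

lemma PF_open_contains_close_on:
  assumes "openin (PF_topology X) U" "p \<in> U"
  obtains F e where "finite F" "F \<subseteq> bounded_functions X" "0 < e"
    "\<And>q. q \<in> PF X \<Longrightarrow> (\<And>f. f \<in> F \<Longrightarrow> \<bar>q f - p f\<bar> < e) \<Longrightarrow> q \<in> U"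
proof -
  let ?B = "bounded_functions X"
  obtain W where W: "openin (product_topology (\<lambda>_. euclideanreal) ?B) W" "U = W \<inter> PF X"
    using assms(1) unfolding PF_topology_eq openin_subtopology by blast
  then obtain V where V: "finite {f \<in> ?B. V f \<noteq> UNIV}" "\<And>f. f \<in> ?B \<Longrightarrow> open (V f)"
      "p \<in> Pi\<^sub>E ?B V" "Pi\<^sub>E ?B V \<subseteq> W"
    using assms(2) unfolding openin_product_topology_alt by (auto dest!: bspec[of W _ p])
  define F where "F = {f \<in> ?B. V f \<noteq> UNIV}"
  have "\<exists>d>0. \<forall>y. \<bar>y - p f\<bar> < d \<longrightarrow> y \<in> V f" if "f \<in> F" for f
  proof -
    have "open (V f)" "p f \<in> V f"
      using that V by (auto simp: F_def)
    then show ?thesis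
      unfolding open_dist dist_real_def by blast
  qed
  then obtain d where d: "\<And>f. f \<in> F \<Longrightarrow> 0 < d f" "\<And>f y. f \<in> F \<Longrightarrow> \<bar>y - p f\<bar> < d f \<Longrightarrow> y \<in> V f"
    by metis
  \<comment> \<open>The \<open>1\<close> covers the case that \<open>F\<close> is empty.\<close>
  define e where "e = Min (insert 1 (d ` F))"
  have F: "finite F" "F \<subseteq> ?B"
    using V(1) by (auto simp: F_def)
  show thesis
  proof (rule that[OF F])
    show "0 < e"
      using F d by (auto simp: e_def)
    fix q assume q: "q \<in> PF X" "\<And>f. f \<in> F \<Longrightarrow> \<bar>q f - p f\<bar> < e"
    have "q f \<in> V f" if "f \<in> ?B" for f
    proof (cases "f \<in> F")
      case True
      then have "e \<le> d f"
        using F by (auto simp: e_def)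
      then show ?thesis
        using d(2)[OF True] q(2)[OF True] by simp
    qed (use that in \<open>auto simp: F_def\<close>)
    then have "q \<in> Pi\<^sub>E ?B V"
      using q(1) by (auto simp: PF_def dual_space_def PiE_def)
    then show "q \<in> U"
      using q(1) W(2) subsetD[OF V(4)] by simp
  qed
qed

text \<open>
  A closed set is determined by its images under finite-dimensional evaluations: a point outside
  a closed set \<open>Q\<close> has a neighbourhood missing \<open>Q\<close> that is described by finitely many functions, and
  the vector consisting of these functions separates the point from \<open>Q\<close>.
\<close>

lemma subset_if_expectations_subset:
  assumes Q: "closedin (PF_topology X) Q" and P: "P \<subseteq> PF X"
    and sub: "\<And>m \<gamma>. bounded_map X m \<gamma> \<Longrightarrow> expectations X P m \<gamma> \<subseteq> expectations X Q m \<gamma>"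
  shows "P \<subseteq> Q"
proof
  fix p assume p: "p \<in> P"
  show "p \<in> Q"
  proof (rule ccontr)
    assume "p \<notin> Q"
    then have "openin (PF_topology X) (PF X - Q)" "p \<in> PF X - Q"
      using Q P p by (auto simp: closedin_def topspace_PF_topology)
    then obtain F e where F: "finite F" "F \<subseteq> bounded_functions X" "0 < e"
        "\<And>q. q \<in> PF X \<Longrightarrow> (\<And>f. f \<in> F \<Longrightarrow> \<bar>q f - p f\<bar> < e) \<Longrightarrow> q \<in> PF X - Q"
      by (rule PF_open_contains_close_on) blast
    obtain fs where fs: "set fs = F"
      using finite_list[OF F(1)] by blast
    define m where "m = length fs"
    define \<gamma> where "\<gamma> x i = (if i < m then (fs ! i) x else 0)" for x :: 'a and i
    have nth: "fs ! i \<in> bounded_functions X" if "i < m" for i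
      using that fs F(2) by (auto simp: m_def)
    have "L2_set (\<gamma> x) {..<m} \<le> (\<Sum>i<m. sup_norm X (fs ! i))" if "x \<in> X" for x
    proof -
      have "L2_set (\<gamma> x) {..<m} \<le> (\<Sum>i<m. \<bar>\<gamma> x i\<bar>)"
        by (rule L2_set_le_sum_abs)
      also have "\<dots> \<le> (\<Sum>i<m. sup_norm X (fs ! i))"
        using that by (intro sum_mono) (auto simp: \<gamma>_def intro: bounded_functions_abs_le_sup_norm nth)
      finally show ?thesis .
    qed
    moreover have "\<gamma> \<in> X \<rightarrow> topspace (Euclidean_space m)"
      by (simp add: topspace_Euclidean_space \<gamma>_def)
    ultimately have "bounded_map X m \<gamma>"
      unfolding bounded_map_def by blast
    moreover have "(\<lambda>i. if i < m then p (\<lambda>x\<in>X. \<gamma> x i) else 0) \<in> expectations X P m \<gamma>"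
      unfolding expectations_def using p by (rule imageI)
    ultimately have "(\<lambda>i. if i < m then p (\<lambda>x\<in>X. \<gamma> x i) else 0) \<in> expectations X Q m \<gamma>"
      using sub by blast
    then obtain q where
        eq: "(\<lambda>i. if i < m then p (\<lambda>x\<in>X. \<gamma> x i) else 0) = (\<lambda>i. if i < m then q (\<lambda>x\<in>X. \<gamma> x i) else 0)"
        and q: "q \<in> Q"
      unfolding expectations_def by (rule imageE)
    have "q f = p f" if f: "f \<in> F" for f
    proof -
      have "f \<in> set fs"
        using f fs by (simp only:)
      then obtain i where i: "i < m" "fs ! i = f"
        unfolding m_def in_set_conv_nth by (elim exE conjE)
      have "(\<lambda>x. \<gamma> x i) = f"
        unfolding \<gamma>_def if_P[OF i(1)] i(2) ..
      moreover have "restrict f X = f"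
        using bounded_functionsD(1)[OF nth[OF i(1)]] unfolding i(2) .
      ultimately have "(\<lambda>x\<in>X. \<gamma> x i) = f"
        by (simp only:)
      moreover have "p (\<lambda>x\<in>X. \<gamma> x i) = q (\<lambda>x\<in>X. \<gamma> x i)"
        using fun_cong[OF eq, of i] unfolding if_P[OF i(1)] .
      ultimately show ?thesis
        by (simp only:)
    qed
    then have close: "\<bar>q f - p f\<bar> < e" if "f \<in> F" for f
      using F(3) that by simp
    have "q \<in> PF X"
      using q closedin_subset[OF Q] by (auto simp: topspace_PF_topology)
    from this close have "q \<in> PF X - Q"
      by (rule F(4))
    then show False
      using q by simp
  qed
qed

section \<open>Empirical measures are dense\<close>

lemma bounded_functions_sum:
  assumes "finite K" "\<And>k. k \<in> K \<Longrightarrow> h k \<in> bounded_functions X"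
  shows "(\<lambda>x\<in>X. \<Sum>k\<in>K. a k * h k x) \<in> bounded_functions X"
    and "p \<in> PF X \<Longrightarrow> p (\<lambda>x\<in>X. \<Sum>k\<in>K. a k * h k x) = (\<Sum>k\<in>K. a k * p (h k))"
proof -
  have "(\<lambda>x\<in>X. \<Sum>k\<in>K. a k * h k x) \<in> bounded_functions X \<and>
    (p \<in> PF X \<longrightarrow> p (\<lambda>x\<in>X. \<Sum>k\<in>K. a k * h k x) = (\<Sum>k\<in>K. a k * p (h k)))"
    using assms
  proof (induction K)
    case empty
    have "(\<lambda>x\<in>X. 0 * char_fun X X x) \<in> bounded_functions X"
      by (rule bounded_functions_scale[OF char_fun_bounded])
    moreover have "p (\<lambda>x\<in>X. 0 * char_fun X X x) = 0" if "p \<in> PF X"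
      using PF_scale[OF that char_fun_bounded, of 0] by simp
    ultimately show ?case
      by (simp add: restrict_def)
  next
    case (insert k K)
    let ?h = "\<lambda>x\<in>X. a k * h k x" and ?s = "\<lambda>x\<in>X. \<Sum>k\<in>K. a k * h k x"
    have eq: "(\<lambda>x\<in>X. \<Sum>k\<in>insert k K. a k * h k x) = (\<lambda>x\<in>X. ?h x + ?s x)"
      using insert by (auto simp: fun_eq_iff)
    have h: "h k \<in> bounded_functions X" "?h \<in> bounded_functions X"       using insert.prems by (auto intro: bounded_functions_scale)
    have IH: "?s \<in> bounded_functions X" "p \<in> PF X \<Longrightarrow> p ?s = (\<Sum>k\<in>K. a k * p (h k))"
      using insert.IH insert.prems by blast+
    have "p (\<lambda>x\<in>X. ?h x + ?s x) = (\<Sum>k\<in>insert k K. a k * p (h k))" if "p \<in> PF X"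
      by (simp only: PF_add[OF that h(2) IH(1)] PF_scale[OF that h(1)] IH(2)[OF that]
          sum.insert[OF insert.hyps])
    then show ?case
      unfolding eq using bounded_functions_add[OF h(2) IH(1)] by blast
  qed
  then show "(\<lambda>x\<in>X. \<Sum>k\<in>K. a k * h k x) \<in> bounded_functions X"
    and "p \<in> PF X \<Longrightarrow> p (\<lambda>x\<in>X. \<Sum>k\<in>K. a k * h k x) = (\<Sum>k\<in>K. a k * p (h k))"
    by auto
qed


text \<open>
  Two points lie in the same cell when every \<open>f \<in> F\<close> rounds to the same multiple of \<open>d\<close> at both.
  Boundedness leaves finitely many cells, and replacing each cell by one of its points turns
  \<open>p\<close> into a finite convex combination of point evaluations, at a cost of at most \<open>d\<close> for each
  \<open>f \<in> F\<close>.
\<close>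

lemma PF_near_finite_convex_combination:
  fixes X :: "'x set"
  assumes p: "p \<in> PF X" and F: "finite F" "F \<subseteq> bounded_functions X" and d: "0 < d"
  obtains K :: "(('x \<Rightarrow> real) \<Rightarrow> int) set" and w r where
    "finite K" "r \<in> K \<rightarrow> X" "\<And>k. k \<in> K \<Longrightarrow> 0 \<le> w k" "sum w K = 1"
    "\<And>f. f \<in> F \<Longrightarrow> \<bar>p f - (\<Sum>k\<in>K. f (r k) * w k)\<bar> \<le> d"
proof -
  define c where "c x = (\<lambda>f\<in>F. \<lfloor>f x / d\<rfloor>)" for x
  define K where "K = c ` X"
  define r where "r = inv_into X c"
  define h where "h k = char_fun X {x \<in> X. c x = k}" for k
  have fin: "finite K"
  proof -
    have "\<exists>B. \<forall>x\<in>X. \<bar>f x\<bar> \<le> B" if "f \<in> F" for f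
      using that F(2) by (auto simp: bounded_functions_def bounded_iff)
    then obtain B where B: "\<And>f x. f \<in> F \<Longrightarrow> x \<in> X \<Longrightarrow> \<bar>f x\<bar> \<le> B f"
      by metis
    have "\<lfloor>f x / d\<rfloor> \<in> {\<lfloor>- B f / d\<rfloor>..\<lfloor>B f / d\<rfloor>}" if "f \<in> F" "x \<in> X" for f x
    proof -
      have "- B f \<le> f x" "f x \<le> B f"
        using B[OF that] by auto
      then show ?thesis
        using d by (intro atLeastAtMost_iff[THEN iffD2] conjI floor_mono divide_right_mono) auto
    qed
    then have "K \<subseteq> (\<Pi>\<^sub>E f\<in>F. {\<lfloor>- B f / d\<rfloor>..\<lfloor>B f / d\<rfloor>})"
      unfolding K_def c_def by (intro image_subsetI restrict_PiE_iff[THEN iffD2] ballI)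
    moreover have "finite (\<Pi>\<^sub>E f\<in>F. {\<lfloor>- B f / d\<rfloor>..\<lfloor>B f / d\<rfloor>})"
      using F(1) by (intro finite_PiE) auto
    ultimately show ?thesis
      by (rule finite_subset)
  qed
  have r: "r k \<in> X" "c (r k) = k" if "k \<in> K" for k
    using that unfolding r_def K_def by (auto intro: inv_into_into f_inv_into_f)
  have h: "h k \<in> bounded_functions X" for k
    unfolding h_def by (rule char_fun_bounded)
  have cells: "(\<Sum>k\<in>K. a k * h k x) = a (c x)" if "x \<in> X" for a :: "_ \<Rightarrow> real" and x
  proof -
    have "(\<Sum>k\<in>K. a k * h k x) = (\<Sum>k\<in>K. if k = c x then a k else 0)"
      using that by (intro sum.cong) (auto simp: h_def char_fun_def)
    then show ?thesis
      using that fin by (simp add: K_def)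
  qed
  show thesis
  proof (rule that[OF fin])
    show "r \<in> K \<rightarrow> X"
      using r(1) by blast
    show "0 \<le> p (h k)" for k
      by (rule PF_nonneg[OF p h]) (simp add: h_def char_fun_def)
    have "(\<lambda>x\<in>X. \<Sum>k\<in>K. 1 * h k x) = char_fun X X"
      using cells[of _ "\<lambda>_. 1"] by (auto simp: char_fun_def fun_eq_iff)
    then show "(\<Sum>k\<in>K. p (h k)) = 1"
      using bounded_functions_sum(2)[where h = h and a = "\<lambda>_. 1", OF fin h p] PF_char_fun_X[OF p] by simp
    fix f assume f: "f \<in> F"
    let ?g = "\<lambda>x\<in>X. \<Sum>k\<in>K. f (r k) * h k x"
    let ?g' = "\<lambda>x\<in>X. (-1) * ?g x"
    have fB: "f \<in> bounded_functions X"
      using f F(2) by blast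
    have g: "?g \<in> bounded_functions X" "p ?g = (\<Sum>k\<in>K. f (r k) * p (h k))"
      by (rule bounded_functions_sum[where h = h, OF fin h],
          rule bounded_functions_sum(2)[where h = h, OF fin h p])
    have g': "?g' \<in> bounded_functions X" "p ?g' = - p ?g"
      using bounded_functions_scale[OF g(1), of "-1"] PF_scale[OF p g(1), of "-1"] by simp_all
    \<comment> \<open>The function \<open>?g\<close> takes at \<open>x\<close> the value of \<open>f\<close> at the chosen point of the cell of \<open>x\<close>.\<close>
    have "\<bar>p (\<lambda>x\<in>X. f x + ?g' x)\<bar> \<le> d"
    proof (rule PF_abs_le[OF p bounded_functions_add[OF fB g'(1)]])
      fix x assume x: "x \<in> X"
      then have "c (r (c x)) = c x"
        by (simp add: r K_def)
      then have "c (r (c x)) f = c x f"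
        by (rule arg_cong)
      then have "\<lfloor>f (r (c x)) / d\<rfloor> = \<lfloor>f x / d\<rfloor>"
        using f by (simp add: c_def)
      then have "\<bar>f x / d - f (r (c x)) / d\<bar> < 1"
        by linarith
      then have "\<bar>f x - f (r (c x))\<bar> < d"
        using d by (simp add: diff_divide_distrib[symmetric] abs_divide)
      then show "\<bar>(\<lambda>x\<in>X. f x + ?g' x) x\<bar> \<le> d"
        using x cells[OF x, of "\<lambda>k. f (r k)"] by simp
    qed
    then show "\<bar>p f - (\<Sum>k\<in>K. f (r k) * p (h k))\<bar> \<le> d"
      unfolding PF_add[OF p fB g'(1)] g' g(2) by simp
  qed
qed

text \<open>
  Repeating the point of weight \<open>w\<close> exactly \<open>\<lceil>N w\<rceil>\<close> times realises rational weights that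
  converge to the given ones as \<open>N\<close> grows. Rounding up makes the length of the tuple at least \<open>N\<close>,
  so that it is non-empty; it need not be equal to \<open>N\<close>, but the quotient tends to \<open>1\<close>.
\<close>

lemma finite_convex_combination_near_average:
  fixes w :: "'k \<Rightarrow> real"
  assumes K: "finite K" "r \<in> K \<rightarrow> X" and w: "\<And>k. k \<in> K \<Longrightarrow> 0 \<le> w k" "sum w K = 1"
    and F: "finite F" and e: "0 < e"
  obtains xs where "xs \<in> tuples X" "\<And>f. f \<in> F \<Longrightarrow> \<bar>list_average f xs - (\<Sum>k\<in>K. f (r k) * w k)\<bar> < e"
proof -
  obtain ks where ks: "set ks = K" "distinct ks"
    using finite_distinct_list[OF K(1)] by blast
  define n where "n N k = nat \<lceil>real N * w k\<rceil>" for N k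
  define xs where "xs N = concat (map (\<lambda>k. replicate (n N k) (r k)) ks)" for N
  have sum_xs: "(\<Sum>x\<leftarrow>xs N. f x) = (\<Sum>k\<in>K. f (r k) * real (n N k))" for f N
  proof -
    have "(\<Sum>x\<leftarrow>xs N. f x) = (\<Sum>k\<leftarrow>ks. f (r k) * real (n N k))"
      unfolding xs_def by (induction ks) (auto simp: sum_list_replicate mult.commute)
    then show ?thesis
      using ks by (simp add: sum_list_distinct_conv_sum_set)
  qed
  have length_xs: "real (length (xs N)) = (\<Sum>k\<in>K. real (n N k))" for N
    using sum_xs[of "\<lambda>_. 1" N] by (simp add: sum_list_triv)
  have n_ge: "real N * w k \<le> real (n N k)" and n_le: "real (n N k) \<le> real N * w k + 1"
    if "k \<in> K" for k N
  proof -
    have "0 \<le> real N * w k"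
      using w(1)[OF that] by simp
    then show "real N * w k \<le> real (n N k)" "real (n N k) \<le> real N * w k + 1"
      unfolding n_def by linarith+
  qed
  have weight: "(\<lambda>N. real (n N k) / real N) \<longlonglongrightarrow> w k" if k: "k \<in> K" for k
  proof (rule tendsto_sandwich)
    show "\<forall>\<^sub>F N in sequentially. w k \<le> real (n N k) / real N"
      using eventually_gt_at_top[of 0]
      by eventually_elim (use n_ge[OF k] in \<open>simp add: field_simps\<close>)
    show "\<forall>\<^sub>F N in sequentially. real (n N k) / real N \<le> w k + 1 / real N"
      using eventually_gt_at_top[of 0]
      by eventually_elim (use n_le[OF k] in \<open>simp add: field_simps\<close>)
    show "(\<lambda>N. w k + 1 / real N) \<longlonglongrightarrow> w k"
      using tendsto_add[OF tendsto_const lim_1_over_n, of "w k"] by simp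
  qed simp
  have "(\<lambda>N. list_average f (xs N)) \<longlonglongrightarrow> (\<Sum>k\<in>K. f (r k) * w k)" for f
  proof -
    have "(\<lambda>N. (\<Sum>k\<in>K. f (r k) * (real (n N k) / real N)) / (\<Sum>k\<in>K. real (n N k) / real N))
        \<longlonglongrightarrow> (\<Sum>k\<in>K. f (r k) * w k) / sum w K"
      by (intro tendsto_divide tendsto_sum tendsto_mult tendsto_const weight) (auto simp: w)
    moreover have "\<forall>\<^sub>F N in sequentially. (\<Sum>k\<in>K. f (r k) * (real (n N k) / real N)) /
        (\<Sum>k\<in>K. real (n N k) / real N) = list_average f (xs N)"
      using eventually_gt_at_top[of 0]
      by eventually_elim (simp add: list_average_def sum_xs length_xs sum_divide_distrib[symmetric])
    ultimately show ?thesis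
      by (simp add: w(2) tendsto_cong)
  qed
  then have "\<forall>\<^sub>F N in sequentially. \<bar>list_average f (xs N) - (\<Sum>k\<in>K. f (r k) * w k)\<bar> < e" for f
    using e by (auto simp: tendsto_iff dist_real_def)
  then have "\<forall>\<^sub>F N in sequentially. \<forall>f\<in>F. \<bar>list_average f (xs N) - (\<Sum>k\<in>K. f (r k) * w k)\<bar> < e"
    using F by (simp add: eventually_ball_finite_distrib)
  then have "\<forall>\<^sub>F N in sequentially. 0 < N \<and>
      (\<forall>f\<in>F. \<bar>list_average f (xs N) - (\<Sum>k\<in>K. f (r k) * w k)\<bar> < e)"
    by (intro eventually_conj eventually_gt_at_top)
  then obtain N where N: "0 < N" "\<And>f. f \<in> F \<Longrightarrow> \<bar>list_average f (xs N) - (\<Sum>k\<in>K. f (r k) * w k)\<bar> < e"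
    by (auto simp: eventually_sequentially)
  have "real N * sum w K \<le> real (length (xs N))"
    unfolding length_xs sum_distrib_left by (intro sum_mono n_ge)
  then have "xs N \<noteq> []"
    using N(1) w(2) by auto
  moreover have "set (xs N) \<subseteq> X"
    using K(2) ks(1) unfolding xs_def by auto
  ultimately have "xs N \<in> tuples X"
    by (auto simp: tuples_def)
  then show thesis
    using N(2) that by blast
qed

lemma empirical_close_on:
  assumes p: "p \<in> PF X" and F: "finite F" "F \<subseteq> bounded_functions X" and e: "0 < e"
  obtains xs where "xs \<in> tuples X" "\<And>f. f \<in> F \<Longrightarrow> \<bar>empirical X xs f - p f\<bar> < e"
proof -
  obtain K :: "(('a \<Rightarrow> real) \<Rightarrow> int) set" and w r where K: "finite K" "r \<in> K \<rightarrow> X"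
      "\<And>k. k \<in> K \<Longrightarrow> 0 \<le> w k" "sum w K = 1"
      "\<And>f. f \<in> F \<Longrightarrow> \<bar>p f - (\<Sum>k\<in>K. f (r k) * w k)\<bar> \<le> e / 2"
    by (rule PF_near_finite_convex_combination[OF p F half_gt_zero[OF e]]) (rule that)
  obtain xs where xs: "xs \<in> tuples X"
      "\<And>f. f \<in> F \<Longrightarrow> \<bar>list_average f xs - (\<Sum>k\<in>K. f (r k) * w k)\<bar> < e / 2"
    using finite_convex_combination_near_average[OF K(1-4) F(1) half_gt_zero[OF e]] by blast
  have "\<bar>empirical X xs f - p f\<bar> < e" if "f \<in> F" for f
  proof -
    have "empirical X xs f = list_average f xs"
      using that F(2) by (auto simp: empirical_def)
    then show ?thesis
      using K(5)[OF that] xs(2)[OF that] by linarith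
  qed
  with xs(1) show thesis
    by (rule that)
qed

section \<open>Regularities of sampling nets\<close>

lemma sampling_netsD:
  assumes "\<phi> \<in> sampling_nets X"
  shows "directed_set (idx \<phi>) (idx_le \<phi>)" "l \<in> idx \<phi> \<Longrightarrow> sample \<phi> l \<in> tuples X"
  using assms by (auto simp: sampling_nets_def)

lemma empirical_net_in_PF:
  assumes "\<phi> \<in> sampling_nets X"
  shows "(\<lambda>l. empirical X (sample \<phi> l)) \<in> idx \<phi> \<rightarrow> topspace (PF_topology X)"
  using empirical_in_PF(1) sampling_netsD(2)[OF assms] by (auto simp: topspace_PF_topology)

lemma net_regularity_in_regularities:
  assumes "\<phi> \<in> sampling_nets X"
  shows "net_regularity X \<phi> \<in> regularities X"
  unfolding regularities_def net_regularity_def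
  using closedin_net_limit_points net_limit_points_nonempty[OF compact_space_PF_topology
      sampling_netsD(1)[OF assms] empirical_net_in_PF[OF assms]] by blast

lemma bounded_map_component:
  assumes "bounded_map X m \<gamma>" "i < m"
  shows "(\<lambda>x\<in>X. \<gamma> x i) \<in> bounded_functions X"
proof -
  obtain B where B: "\<And>x. x \<in> X \<Longrightarrow> L2_set (\<gamma> x) {..<m} \<le> B"
    using assms(1) by (auto simp: bounded_map_def)
  have "\<bar>\<gamma> x i\<bar> \<le> B" if "x \<in> X" for x
  proof -
    have "\<bar>\<gamma> x i\<bar> \<le> L2_set (\<lambda>i. \<bar>\<gamma> x i\<bar>) {..<m}"
      using assms(2) by (intro member_le_L2_set) auto
    also have "\<dots> = L2_set (\<gamma> x) {..<m}"
      by (simp add: L2_set_def)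
    finally show ?thesis
      using B[OF that] by simp
  qed
  then have "bounded ((\<lambda>x. \<gamma> x i) ` X)"
    by (auto simp: bounded_iff)
  then show ?thesis
    by (simp add: restrict_bounded_functions_iff)
qed

text \<open>
  The averages of \<open>\<gamma>\<close> are the values of a continuous map at the empirical measures.
\<close>

lemma average_limit_points_eq_expectations:
  fixes X :: "'x set"
  assumes \<phi>: "\<phi> \<in> sampling_nets X" and \<gamma>: "bounded_map X m \<gamma>"
  shows "average_limit_points \<phi> m \<gamma> = expectations X (net_regularity X \<phi>) m \<gamma>"
proof -
  define e where "e p i = (if i < m then p (\<lambda>x\<in>X. \<gamma> x i) else 0)"
    for p :: "('x \<Rightarrow> real) \<Rightarrow> real" and i
  have cont: "continuous_map (PF_topology X) (Euclidean_space m) e"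
  proof -
    have "continuous_map (PF_topology X) euclideanreal (\<lambda>p. e p i)" for i
      by (cases "i < m") (simp_all add: e_def continuous_map_evaluation bounded_map_component[OF \<gamma>])
    then show ?thesis
      by (auto simp: Euclidean_space_def continuous_map_in_subtopology
          continuous_map_componentwise_UNIV e_def)
  qed
  have avg: "(\<lambda>i. list_average (\<lambda>x. \<gamma> x i) (sample \<phi> l)) = e (empirical X (sample \<phi> l))"
    if "l \<in> idx \<phi>" for l
  proof
    fix i
    have xs: "sample \<phi> l \<in> tuples X"
      using sampling_netsD(2)[OF \<phi> that] .
    show "list_average (\<lambda>x. \<gamma> x i) (sample \<phi> l) = e (empirical X (sample \<phi> l)) i"
    proof (cases "i < m")
      case True
      then show ?thesis
        using bounded_map_component[OF \<gamma>] list_average_restrict[OF xs] by (simp add: e_def empirical_def)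
    next
      case False
      moreover have "\<gamma> x \<in> topspace (Euclidean_space m)" if "x \<in> X" for x
        using \<gamma> that by (auto simp: bounded_map_def)
      ultimately have "\<gamma> x i = 0" if "x \<in> X" for x
        using that by (simp add: topspace_Euclidean_space)
      then have zero: "restrict (\<lambda>x. \<gamma> x i) X = restrict (\<lambda>_. 0) X"
        by (rule restrict_ext)
      have "list_average (\<lambda>x. \<gamma> x i) (sample \<phi> l) = list_average (\<lambda>_. 0) (sample \<phi> l)"
        using list_average_restrict[OF xs, of "\<lambda>x. \<gamma> x i"] list_average_restrict[OF xs, of "\<lambda>_. 0"]
        unfolding zero by (rule trans[OF sym])
      then show ?thesis
        using False by (simp add: e_def list_average_def)
    qed
  qed
  have "average_limit_points \<phi> m \<gamma> = net_limit_points (Euclidean_space m) (idx \<phi>) (idx_le \<phi>)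
      (\<lambda>l. e (empirical X (sample \<phi> l)))"
    unfolding average_limit_points_def by (rule net_limit_points_cong) (rule avg)
  also have "\<dots> = e ` net_regularity X \<phi>"
    unfolding net_regularity_def
    by (rule net_limit_points_continuous_image[OF compact_space_PF_topology _ cont
          sampling_netsD(1)[OF \<phi>] empirical_net_in_PF[OF \<phi>]])
      (simp add: Euclidean_space_def Hausdorff_space_subtopology Hausdorff_space_product_topology)
  also have "\<dots> = expectations X (net_regularity X \<phi>) m \<gamma>"
    unfolding expectations_def e_def ..
  finally show ?thesis .
qed

lemma S_equivalent_iff_net_regularity_eq:
  assumes "\<phi> \<in> sampling_nets X" "\<psi> \<in> sampling_nets X"
  shows "S_equivalent X \<phi> \<psi> \<longleftrightarrow> net_regularity X \<phi> = net_regularity X \<psi>"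
proof -
  have avg: "average_limit_points \<phi> m \<gamma> = expectations X (net_regularity X \<phi>) m \<gamma>"
    "average_limit_points \<psi> m \<gamma> = expectations X (net_regularity X \<psi>) m \<gamma>"
    if "bounded_map X m \<gamma>" for m \<gamma>
    by (rule average_limit_points_eq_expectations[OF assms(1) that],
        rule average_limit_points_eq_expectations[OF assms(2) that])
  have cl: "closedin (PF_topology X) (net_regularity X \<phi>)" "closedin (PF_topology X) (net_regularity X \<psi>)"
    unfolding net_regularity_def by (rule closedin_net_limit_points)+
  have PF: "net_regularity X \<phi> \<subseteq> PF X" "net_regularity X \<psi> \<subseteq> PF X"
    using cl[THEN closedin_subset] unfolding topspace_PF_topology .
  show ?thesis
  proof
    assume "S_equivalent X \<phi> \<psi>"
    then have eq: "expectations X (net_regularity X \<phi>) m \<gamma> = expectations X (net_regularity X \<psi>) m \<gamma>"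
      if "bounded_map X m \<gamma>" for m \<gamma>
      using that unfolding S_equivalent_def avg[OF that, symmetric] by blast
    show "net_regularity X \<phi> = net_regularity X \<psi>"
    proof
      show "net_regularity X \<phi> \<subseteq> net_regularity X \<psi>"
        by (rule subset_if_expectations_subset[OF cl(2) PF(1)]) (simp only: eq order_refl)
      show "net_regularity X \<psi> \<subseteq> net_regularity X \<phi>"
        by (rule subset_if_expectations_subset[OF cl(1) PF(2)]) (simp only: eq order_refl)
    qed
  next
    assume "net_regularity X \<phi> = net_regularity X \<psi>"
    then show "S_equivalent X \<phi> \<psi>"
      unfolding S_equivalent_def by (intro allI impI) (simp only: avg)
  qed
qed

text \<open>
  An index consists of the requirement to come close to \<open>P\<close> on the finite set \<open>F\<close>, up to
  \<open>1 / (n + 1)\<close>, and of a tuple \<open>xs\<close> that meets it for some \<open>p \<in> P\<close>; only the requirements are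
  compared. Storing the tuple in the index, instead of choosing one for each requirement, lets every
  element of \<open>P\<close> be approached from arbitrarily late indices.
\<close>

lemma regularity_has_sampling_net:
  fixes X :: "'x set"
  assumes P: "P \<in> regularities X"
  shows "\<exists>\<phi> \<in> (sampling_nets X :: ('x large_index, 'x) sampling_net set). net_regularity X \<phi> = P"
proof -
  have PF: "P \<subseteq> PF X" and ne: "P \<noteq> {}" and cl: "closedin (PF_topology X) P"
    using P closedin_subset[of "PF_topology X" P] by (auto simp: regularities_def topspace_PF_topology)
  define \<Lambda> :: "'x large_index set" where "\<Lambda> = {(F, n, xs). finite F \<and> F \<subseteq> bounded_functions X \<and>
    xs \<in> tuples X \<and> (\<exists>p\<in>P. \<forall>f\<in>F. \<bar>empirical X xs f - p f\<bar> < inverse (real (Suc n)))}"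
  define le :: "'x large_index \<Rightarrow> 'x large_index \<Rightarrow> bool" where
    "le = (\<lambda>(F, n, xs) (F', n', xs'). F \<subseteq> F' \<and> n \<le> n')"
  define \<phi> :: "('x large_index, 'x) sampling_net" where
    "\<phi> = \<lparr>idx = \<Lambda>, idx_le = le, sample = \<lambda>(F, n, xs). xs\<rparr>"
  have late: "\<exists>xs. (F, n, xs) \<in> \<Lambda> \<and> (\<forall>f\<in>F. \<bar>empirical X xs f - p f\<bar> < inverse (real (Suc n)))"
    if p: "p \<in> P" and F: "finite F" "F \<subseteq> bounded_functions X" for p F n
  proof -
    have "p \<in> PF X" "0 < inverse (real (Suc n))"
      using p PF by auto
    then obtain xs where "xs \<in> tuples X" "\<And>f. f \<in> F \<Longrightarrow> \<bar>empirical X xs f - p f\<bar> < inverse (real (Suc n))"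
      using empirical_close_on[OF _ F] by blast
    then show ?thesis
      using p F unfolding \<Lambda>_def by blast
  qed
  have "directed_set \<Lambda> le"
    unfolding directed_set_def
  proof (intro conjI ballI)
    obtain p where p: "p \<in> P"
      using ne by blast
    show "\<Lambda> \<noteq> {}"
      using late[OF p, of "{}"] by blast
    show "reflp_on \<Lambda> le" "transp_on \<Lambda> le"
      by (auto simp: reflp_on_def transp_on_def le_def)
    fix a b assume ab: "a \<in> \<Lambda>" "b \<in> \<Lambda>"
    obtain F n xs F' n' xs' where eq: "a = (F, n, xs)" "b = (F', n', xs')"
      by (metis prod_cases3)
    have "finite (F \<union> F')" "F \<union> F' \<subseteq> bounded_functions X"
      using ab by (auto simp: eq \<Lambda>_def)
    then obtain ys where "(F \<union> F', max n n', ys) \<in> \<Lambda>"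
      using late[OF p] by blast
    moreover have "le a (F \<union> F', max n n', ys)" "le b (F \<union> F', max n n', ys)"
      by (auto simp: eq le_def)
    ultimately show "\<exists>c\<in>\<Lambda>. le a c \<and> le b c"
      by blast
  qed
  then have \<phi>_in: "\<phi> \<in> sampling_nets X"
    by (auto simp: sampling_nets_def \<phi>_def \<Lambda>_def)
  have lim: "net_regularity X \<phi> = {q \<in> PF X. \<forall>V. openin (PF_topology X) V \<and> q \<in> V \<longrightarrow>
      (\<forall>a\<in>\<Lambda>. \<exists>b\<in>\<Lambda>. le a b \<and> empirical X (sample \<phi> b) \<in> V)}"
    by (simp add: net_regularity_def net_limit_points_def topspace_PF_topology \<phi>_def)
  have "p \<in> net_regularity X \<phi>" if p: "p \<in> P" for p
    unfolding lim
  proof (intro CollectI conjI allI impI ballI)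
    show "p \<in> PF X"
      using p PF by blast
    fix V a assume V: "openin (PF_topology X) V \<and> p \<in> V" and a: "a \<in> \<Lambda>"
    obtain F e where F: "finite F" "F \<subseteq> bounded_functions X" "0 < e"
        "\<And>q. q \<in> PF X \<Longrightarrow> (\<And>f. f \<in> F \<Longrightarrow> \<bar>q f - p f\<bar> < e) \<Longrightarrow> q \<in> V"
      by (rule PF_open_contains_close_on[OF conjunct1[OF V] conjunct2[OF V]]) blast
    obtain F0 n0 xs0 where a_eq: "a = (F0, n0, xs0)"
      by (metis prod_cases3)
    obtain n1 where n1: "inverse (real (Suc n1)) < e"
      using reals_Archimedean[OF F(3)] by blast
    \<comment> \<open>The index has to lie above \<open>a\<close> and also demand more than \<open>V\<close> does.\<close>
    define n where "n = max n0 n1"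
    have n: "inverse (real (Suc n)) < e"
      using n1 by (rule le_less_trans[rotated]) (simp add: n_def le_imp_inverse_le)
    have "finite (F0 \<union> F)" "F0 \<union> F \<subseteq> bounded_functions X"
      using a F by (auto simp: a_eq \<Lambda>_def)
    then obtain xs where xs: "(F0 \<union> F, n, xs) \<in> \<Lambda>"
        "\<forall>f\<in>F0 \<union> F. \<bar>empirical X xs f - p f\<bar> < inverse (real (Suc n))"
      using late[OF p] by blast
    have "xs \<in> tuples X"
      using xs(1) by (simp add: \<Lambda>_def)
    then have "empirical X xs \<in> V"
    proof (intro F(4))
      show "\<bar>empirical X xs f - p f\<bar> < e" if "f \<in> F" for f
        using xs(2) n that by (auto intro: less_trans)
    qed (rule empirical_in_PF(1))
    moreover have "le a (F0 \<union> F, n, xs)"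
      by (auto simp: a_eq le_def n_def)
    ultimately show "\<exists>b\<in>\<Lambda>. le a b \<and> empirical X (sample \<phi> b) \<in> V"
      using xs(1) by (intro bexI[of _ "(F0 \<union> F, n, xs)"]) (auto simp: \<phi>_def)
  qed
  moreover have "q \<in> P" if q: "q \<in> net_regularity X \<phi>" for q
  proof (rule ccontr)
    assume "q \<notin> P"
    then have "q \<in> PF X - P"
      using q by (auto simp: lim)
    have "openin (PF_topology X) (PF X - P)"
      using cl by (auto simp: closedin_def topspace_PF_topology)
    from this \<open>q \<in> PF X - P\<close> obtain F e where F: "finite F" "F \<subseteq> bounded_functions X" "0 < e"
        "\<And>p. p \<in> PF X \<Longrightarrow> (\<And>f. f \<in> F \<Longrightarrow> \<bar>p f - q f\<bar> < e) \<Longrightarrow> p \<in> PF X - P"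
      by (rule PF_open_contains_close_on) blast
    \<comment> \<open>Half of \<open>e\<close> bounds the distance of \<open>q\<close> from an empirical measure, the other half the distance
      of that measure from an element of \<open>P\<close>.\<close>
    define V where "V = {p \<in> PF X. \<forall>f\<in>F. \<bar>p f - q f\<bar> < e / 2}"
    have V: "openin (PF_topology X) V"
      unfolding V_def by (rule openin_PF_close_on[OF F(1,2)])
    have qV: "q \<in> V"
      using q F(3) by (simp add: V_def lim)
    obtain n where n: "inverse (real (Suc n)) < e / 2"
      using reals_Archimedean[OF half_gt_zero[OF F(3)]] by blast
    obtain p0 where "p0 \<in> P"
      using ne by blast
    then obtain xs0 where xs0: "(F, n, xs0) \<in> \<Lambda>"
      using late[OF _ F(1,2)] by blast
    then have "\<exists>b\<in>\<Lambda>. le (F, n, xs0) b \<and> empirical X (sample \<phi> b) \<in> V"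
      using q V qV by (simp add: lim)
    then obtain b where b: "b \<in> \<Lambda>" "le (F, n, xs0) b" "empirical X (sample \<phi> b) \<in> V"
      by blast
    obtain F' n' xs where b_eq: "b = (F', n', xs)"
      by (metis prod_cases3)
    have sub: "F \<subseteq> F'" "n \<le> n'" and close: "\<forall>f\<in>F. \<bar>empirical X xs f - q f\<bar> < e / 2"
      using b(2,3) by (auto simp: b_eq le_def \<phi>_def V_def)
    obtain p where p: "p \<in> P" "\<forall>f\<in>F'. \<bar>empirical X xs f - p f\<bar> < inverse (real (Suc n'))"
      using b(1) by (auto simp: b_eq \<Lambda>_def)
    have n': "inverse (real (Suc n')) < e / 2"
      using n by (rule le_less_trans[rotated]) (use sub(2) in \<open>simp add: le_imp_inverse_le\<close>)
    have "\<bar>p f - q f\<bar> < e" if "f \<in> F" for f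
    proof -
      have "\<bar>empirical X xs f - p f\<bar> < inverse (real (Suc n'))"
        using p(2) sub(1) that by blast
      moreover have "\<bar>empirical X xs f - q f\<bar> < e / 2"
        using close that by blast
      ultimately show ?thesis
        using n' by linarith
    qed
    moreover have "p \<in> PF X"
      using p(1) PF by blast
    ultimately have "p \<in> PF X - P"
      by (intro F(4))
    then show False
      using p(1) by simp
  qed
  ultimately have "net_regularity X \<phi> = P"
    by blast
  with \<phi>_in show ?thesis
    by blast
qed

section \<open>Classes of S-equivalence\<close>

lemma equiv_kernel: "equiv A {(a, b). a \<in> A \<and> b \<in> A \<and> f a = f b}"
  by (rule equivI) (auto intro!: refl_onI symI transI)

lemma bij_betw_quotient_kernel:
  assumes "r = {(a, b). a \<in> A \<and> b \<in> A \<and> f a = f b}" "f ` A = B"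
  shows "bij_betw (\<lambda>C. the_elem (f ` C)) (A // r) B"
proof -
  have the_value: "the_elem (f ` (r `` {a})) = f a" if "a \<in> A" for a
  proof -
    have "f ` (r `` {a}) = {f a}"
      using that by (auto simp: assms(1))
    then show ?thesis
      by simp
  qed
  show ?thesis
  proof (rule bij_betw_imageI)
    show "inj_on (\<lambda>C. the_elem (f ` C)) (A // r)"
    proof (rule inj_onI)
      fix C D assume "C \<in> A // r" "D \<in> A // r" and eq: "the_elem (f ` C) = the_elem (f ` D)"
      then obtain a b where ab: "a \<in> A" "b \<in> A" "C = r `` {a}" "D = r `` {b}"
        by (elim quotientE)
      then have "f a = f b"
        using eq the_value by simp
      then show "C = D"
        using ab by (auto simp: assms(1))
    qed
    have "A // r = (\<lambda>a. r `` {a}) ` A"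
      by (auto simp: quotient_def)
    then have "(\<lambda>C. the_elem (f ` C)) ` (A // r) = (\<lambda>a. the_elem (f ` (r `` {a}))) ` A"
      by (simp only: image_image)
    also have "\<dots> = B"
      unfolding assms(2)[symmetric] by (rule image_cong[OF refl the_value])
    finally show "(\<lambda>C. the_elem (f ` C)) ` (A // r) = B" .
  qed
qed

lemma S_equivalence_eq_kernel:
  "S_equivalence X =
    {(\<phi>, \<psi>). \<phi> \<in> sampling_nets X \<and> \<psi> \<in> sampling_nets X \<and> net_regularity X \<phi> = net_regularity X \<psi>}"
  unfolding S_equivalence_def
  by (simp add: S_equivalent_iff_net_regularity_eq cong: conj_cong)

theorem theorem1:
  fixes X :: "'x set"
  shows
    "(\<forall>\<phi> \<in> (sampling_nets X :: ('i, 'x) sampling_net set). \<forall>m \<gamma>. bounded_map X m \<gamma> \<longrightarrow>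
        average_limit_points \<phi> m \<gamma> = expectations X (net_regularity X \<phi>) m \<gamma>)
   \<and> (\<forall>\<phi>\<^sub>1 \<in> (sampling_nets X :: ('i, 'x) sampling_net set).
      \<forall>\<phi>\<^sub>2 \<in> (sampling_nets X :: ('j, 'x) sampling_net set).
        S_equivalent X \<phi>\<^sub>1 \<phi>\<^sub>2 \<longleftrightarrow> net_regularity X \<phi>\<^sub>1 = net_regularity X \<phi>\<^sub>2)
   \<and> (\<forall>\<phi> \<in> (sampling_nets X :: ('i, 'x) sampling_net set). net_regularity X \<phi> \<in> regularities X)
   \<and> (\<forall>P \<in> regularities X.
      \<exists>\<phi> \<in> (sampling_nets X :: ('x large_index, 'x) sampling_net set). net_regularity X \<phi> = P)
   \<and> (\<forall>\<phi> \<in> (sampling_nets X :: ('i, 'x) sampling_net set).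
      \<exists>\<psi> \<in> (sampling_nets X :: ('x large_index, 'x) sampling_net set). S_equivalent X \<phi> \<psi>)
   \<and> equiv (sampling_nets X) (S_equivalence X :: ('x large_index, 'x) sampling_net rel)
   \<and> bij_betw (\<lambda>C. the_elem (net_regularity X ` C))
       ((sampling_nets X :: ('x large_index, 'x) sampling_net set) // S_equivalence X)
       (regularities X)"
proof (intro conjI ballI allI impI)
  fix \<phi> :: "('i, 'x) sampling_net" and m \<gamma>
  assume "\<phi> \<in> sampling_nets X" "bounded_map X m \<gamma>"
  then show "average_limit_points \<phi> m \<gamma> = expectations X (net_regularity X \<phi>) m \<gamma>"
    by (rule average_limit_points_eq_expectations)
next
  fix \<phi>\<^sub>1 :: "('i, 'x) sampling_net" and \<phi>\<^sub>2 :: "('j, 'x) sampling_net"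
  assume "\<phi>\<^sub>1 \<in> sampling_nets X" "\<phi>\<^sub>2 \<in> sampling_nets X"
  then show "S_equivalent X \<phi>\<^sub>1 \<phi>\<^sub>2 \<longleftrightarrow> net_regularity X \<phi>\<^sub>1 = net_regularity X \<phi>\<^sub>2"
    by (rule S_equivalent_iff_net_regularity_eq)
next
  fix \<phi> :: "('i, 'x) sampling_net"
  assume "\<phi> \<in> sampling_nets X"
  then show "net_regularity X \<phi> \<in> regularities X"
    by (rule net_regularity_in_regularities)
next
  fix P assume "P \<in> regularities X"
  then show "\<exists>\<phi> \<in> (sampling_nets X :: ('x large_index, 'x) sampling_net set). net_regularity X \<phi> = P"
    by (rule regularity_has_sampling_net)
next
  fix \<phi> :: "('i, 'x) sampling_net"
  assume \<phi>: "\<phi> \<in> sampling_nets X"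
  obtain \<psi> :: "('x large_index, 'x) sampling_net" where
    \<psi>: "\<psi> \<in> sampling_nets X" "net_regularity X \<psi> = net_regularity X \<phi>"
    using regularity_has_sampling_net[OF net_regularity_in_regularities[OF \<phi>]] by blast
  then have "S_equivalent X \<phi> \<psi>"
    using S_equivalent_iff_net_regularity_eq[OF \<phi> \<psi>(1)] by simp
  with \<psi>(1) show "\<exists>\<psi> \<in> (sampling_nets X :: ('x large_index, 'x) sampling_net set). S_equivalent X \<phi> \<psi>"
    by blast
next
  show "equiv (sampling_nets X) (S_equivalence X :: ('x large_index, 'x) sampling_net rel)"
    unfolding S_equivalence_eq_kernel by (rule equiv_kernel)
next
  have "net_regularity X ` (sampling_nets X :: ('x large_index, 'x) sampling_net set) = regularities X"
    using net_regularity_in_regularities[of _ X] regularity_has_sampling_net[of _ X] by blast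
  then show "bij_betw (\<lambda>C. the_elem (net_regularity X ` C))
      ((sampling_nets X :: ('x large_index, 'x) sampling_net set) // S_equivalence X) (regularities X)"
    by (rule bij_betw_quotient_kernel[OF S_equivalence_eq_kernel])
qed

end
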